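(* Let $n\ge 1$ be an integer, let $p_0,\dots,p_{n-1}$ be elements of a commutative ring with identity, and let $\{X_k\}_{k\ge 0}$ be the sequence with $X_0=\dots=X_{n-2}=0$, $X_{n-1}=1$ and $X_{k+n}=\sum_{i=0}^{n-1}p_iX_{k+n-1-i}$ for all $k\ge 0$. Put $e=n\bmod 2\in\{0,1\}$ and $v=n/2-1$. Then for every $k\ge 0$ $$X_{2k}=e\,X_{k+(n-1)/2}^2+\sum_{i=0}^{\lfloor v\rfloor}X_{k+\lfloor v\rfloor-i}\Bigl(2X_{k+\lceil v\rceil+1+i}-p_{2i+e}X_{k+\lfloor v\rfloor-i}-2\sum_{j=0}^{2i-1+e}p_jX_{k+\lceil v\rceil+i-j}\Bigr)$$ and $$X_{2k+1}=p_{n-1}X_k^2+(1-e)X_{k+n/2}^2+\sum_{i=0}^{\lceil v\rceil-1}X_{k+\lceil v\rceil-i}\Bigl(2X_{k+\lfloor v\rfloor+2+i}-p_{2i+1-e}X_{k+\lceil v\rceil-i}-2\sum_{j=0}^{2i-e}p_jX_{k+\lfloor v\rfloor+1+i-j}\Bigr).$$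
   Context: Empty sums (upper limit smaller than lower limit) are $0$. The term $e\,X_{k+(n-1)/2}^2$ is read as $0$ when $n$ is even, and the term $(1-e)X_{k+n/2}^2$ is read as $0$ when $n$ is odd. *)

theory Defs
  imports Complex_Main
begin

end

(* The Hankel form B(a,b) = X (a+b) of the impulse response X expands along the Horner tails
   D s b = X (b+n-1-s) - sum_{j<n-1-s} p j * X (b+n-2-s-j): X (a+b) = sum_{s<n} X (a+s) * D s b, because
   the right-hand side does not change when one unit is moved from b to a, and is X b at a = 0.
   Taking (a,b) = (k,k) and (k+1,k) expresses X (2k) and X (2k+1) through the palindromic
   convolutions sum_{s<m} X (c+s) * X (c+m-1-s), which are folded by peeling off both end terms. *)

theory Submission
  imports Defs
begin

section \<open>Palindromic convolutions and their folding\<close>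

definition pconv :: "(nat \<Rightarrow> 'a :: comm_ring) \<Rightarrow> nat \<Rightarrow> nat \<Rightarrow> 'a" where
  "pconv X c m = (\<Sum>s<m. X (c + s) * X (c + (m - 1 - s)))"

lemma pconv_0 [simp]: "pconv X c 0 = 0"
  and pconv_1 [simp]: "pconv X c (Suc 0) = X c * X c"
  by (simp_all add: pconv_def)

lemma pconv_Suc_base: "pconv X (Suc c) m = (\<Sum>s<m. X (Suc c + s) * X (c + (m - s)))"
  unfolding pconv_def by (intro sum.cong refl) (auto simp: Suc_diff_Suc)

text \<open>By commutativity both end products, s = 0 and s = m + 1, are the same. What lies between
  them is again palindromic, two terms shorter and based one higher.\<close>

lemma pconv_Suc_Suc:
  "pconv X c (Suc (Suc m)) = X c * X (c + Suc m) + X c * X (c + Suc m) + pconv X (Suc c) m"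
proof -
  have "pconv X c (Suc (Suc m))
      = (\<Sum>s<m. X (Suc c + s) * X (c + (m - s))) + X c * X (c + Suc m) + X (c + Suc m) * X c"
    unfolding pconv_def by (subst sum.lessThan_Suc, subst sum.lessThan_Suc_shift) (simp add: algebra_simps)
  then show ?thesis
    unfolding pconv_Suc_base by (simp add: algebra_simps)
qed

text \<open>Peeling both ends of every convolution yields the outermost summand i = h - 1 and leaves
  the same expression at base \<open>Suc c\<close> with h lowered by one; hence c varies in the
  induction. An odd length finally leaves the middle square. The sort describes commutative rings
  with identity, the zero ring included.\<close>

lemma pconv_fold:
  fixes p X :: "nat \<Rightarrow> 'a :: {comm_ring, semiring_numeral}"
  assumes "d < 2"
  shows "pconv X c (2 * h + d) - (\<Sum>j<2 * h + d. p j * pconv X c (2 * h + d - 1 - j))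
    = (if d = 1 then X (c + h) ^ 2 else 0)
      + (\<Sum>i<h. X (c + (h - 1 - i)) *
          (2 * X (c + h + d + i) - p (2 * i + d) * X (c + (h - 1 - i))
            - 2 * (\<Sum>j<2 * i + d. p j * X (c + h + d + i - 1 - j))))"
proof (induction h arbitrary: c)
  case 0
  have "d = 0 \<or> d = 1" using assms by auto
  then show ?case by (auto simp: power2_eq_square)
next
  case (Suc h)
  define M where "M = 2 * h + d"
  \<comment> \<open>For j < M the length \<open>Suc M - j\<close> is at least two, so each of these
    convolutions has two ends to peel.\<close>
  have inner: "(\<Sum>j<M. p j * pconv X c (Suc M - j))
      = (\<Sum>j<M. p j * (2 * (X c * X (c + (M - j))))) + (\<Sum>j<M. p j * pconv X (Suc c) (M - 1 - j))"
    unfolding sum.distrib [symmetric]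
  proof (intro sum.cong refl)
    fix j assume "j \<in> {..<M}"
    then obtain r where r: "M = Suc (j + r)"
      using less_imp_Suc_add by blast
    have "pconv X c (Suc M - j)
        = X c * X (c + (M - j)) + X c * X (c + (M - j)) + pconv X (Suc c) (M - 1 - j)"
      by (simp add: r pconv_Suc_Suc)
    then show "p j * pconv X c (Suc M - j)
        = p j * (2 * (X c * X (c + (M - j)))) + p j * pconv X (Suc c) (M - 1 - j)"
      by (simp only: mult_2 distrib_left)
  qed
  have pull: "(\<Sum>j<M. p j * (2 * (X c * X (c + (M - j))))) = X c * (2 * (\<Sum>j<M. p j * X (c + (M - j))))"
    by (simp add: sum_distrib_left mult_2 algebra_simps sum.distrib)
  have tail: "(\<Sum>i<h. X (Suc c + (h - 1 - i)) *
          (2 * X (Suc c + h + d + i) - p (2 * i + d) * X (Suc c + (h - 1 - i))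
            - 2 * (\<Sum>j<2 * i + d. p j * X (Suc c + h + d + i - 1 - j))))
      = (\<Sum>i<h. X (c + (h - i)) *
          (2 * X (c + Suc h + d + i) - p (2 * i + d) * X (c + (h - i))
            - 2 * (\<Sum>j<2 * i + d. p j * X (c + Suc h + d + i - 1 - j))))"
    by (intro sum.cong refl) (auto simp: Suc_diff_Suc)
  have idx: "(\<Sum>j<M. p j * X (c + Suc h + d + h - 1 - j)) = (\<Sum>j<M. p j * X (c + (M - j)))"
  proof -
    have "M = h + h + d" by (simp add: M_def)
    then show ?thesis by (simp add: ac_simps)
  qed
  have idx': "X (c + Suc h + d + h) = X (c + Suc M)"
    by (rule arg_cong) (simp add: M_def)
  \<comment> \<open>The indices j = M and j = M + 1 leave convolutions of length one and zero: the
    first supplies \<open>p M * X c * X c\<close>, the second vanishes.\<close>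
  have "pconv X c (Suc (Suc M)) - (\<Sum>j<Suc (Suc M). p j * pconv X c (Suc M - j))
     = X c * (2 * X (c + Suc M) - p M * X c - 2 * (\<Sum>j<M. p j * X (c + (M - j))))
       + (pconv X (Suc c) M - (\<Sum>j<M. p j * pconv X (Suc c) (M - 1 - j)))"
    unfolding sum.lessThan_Suc inner pull
    by (simp add: pconv_Suc_Suc mult_2 algebra_simps Suc_diff_le)
  also have "pconv X (Suc c) M - (\<Sum>j<M. p j * pconv X (Suc c) (M - 1 - j))
     = (if d = 1 then X (c + Suc h) ^ 2 else 0)
      + (\<Sum>i<h. X (c + (h - i)) *
          (2 * X (c + Suc h + d + i) - p (2 * i + d) * X (c + (h - i))
            - 2 * (\<Sum>j<2 * i + d. p j * X (c + Suc h + d + i - 1 - j))))"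
    unfolding tail [symmetric] unfolding M_def Suc.IH by simp
  finally show ?case
    using idx idx' by (simp add: M_def algebra_simps)
qed

section \<open>The Hankel form and its expansion along Horner tails\<close>

context
  fixes N :: nat and p X :: "nat \<Rightarrow> 'a :: {comm_ring, semiring_numeral}"
  assumes init_0: "\<And>j. j < N \<Longrightarrow> X j = 0"
    and init_1: "X N = 1"
    and rec: "\<And>k. X (k + Suc N) = (\<Sum>i<Suc N. p i * X (k + N - i))"
begin

text \<open>Here N = n - 1. With t^i read as X (b + i), this is the Horner polynomial t^(N-s) - p_0
  t^(N-s-1) - ... - p_(N-s-1) of the characteristic polynomial.\<close>

definition horner_tail :: "nat \<Rightarrow> nat \<Rightarrow> 'a" where
  "horner_tail s b = X (b + (N - s)) - (\<Sum>j<N - s. p j * X (b + (N - 1 - s - j)))"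

text \<open>This is one Horner step: raising b by one multiplies by t, after which the next
  coefficient is subtracted.\<close>

lemma horner_tail_Suc:
  assumes "s < N"
  shows "horner_tail s b = horner_tail (Suc s) (Suc b) - p (N - Suc s) * X b"
proof -
  obtain r where r: "N = Suc (s + r)"
    using assms less_imp_Suc_add by blast
  have "(\<Sum>j<r. p j * X (b + (r - j))) = (\<Sum>j<r. p j * X (Suc (b + (r - Suc j))))"
    by (intro sum.cong refl) (auto simp: Suc_diff_Suc simp flip: add_Suc_right)
  then show ?thesis
    unfolding horner_tail_def by (simp add: r)
qed

text \<open>The longest tail subtracts every term of the recurrence except the last, i = N, which
  therefore remains.\<close>

lemma horner_tail_0_Suc: "horner_tail 0 (Suc b) = p N * X b"
proof -
  have "(\<Sum>j<N. p j * X (Suc b + (N - 1 - j))) = (\<Sum>j<N. p j * X (b + N - j))"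
    by (intro sum.cong refl) (auto simp: Suc_diff_Suc)
  then show ?thesis
    using rec [of b] by (simp add: horner_tail_def)
qed

text \<open>For s < N a Horner step turns the product at s on the left into the product at s + 1 on
  the right, minus a multiple of X b. The term s = N is \<open>X (a + Suc N) * X b\<close>; expanded
  by the recurrence, it cancels these corrections and leaves \<open>p N * X a * X b\<close>, the
  product at s = 0 on the right.\<close>

lemma hankel_shift:
  "(\<Sum>s<Suc N. X (Suc a + s) * horner_tail s b) = (\<Sum>s<Suc N. X (a + s) * horner_tail s (Suc b))"
proof -
  have "(\<Sum>s<N. X (Suc a + s) * horner_tail s b)
      = (\<Sum>s<N. X (a + Suc s) * horner_tail (Suc s) (Suc b)) - (\<Sum>s<N. X (a + Suc s) * p (N - Suc s)) * X b"
    by (simp add: horner_tail_Suc algebra_simps sum_distrib_left sum_subtractf)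
  moreover have "X (a + Suc N) = p N * X a + (\<Sum>s<N. X (a + Suc s) * p (N - Suc s))"
  proof -
    \<comment> \<open>The reflection s = N - 1 - i is needed because in the recurrence the index of
      X falls as that of p rises.\<close>
    have "(\<Sum>s<N. X (a + Suc s) * p (N - Suc s)) = (\<Sum>i<N. p i * X (a + N - i))"
      by (rule trans [OF sum.nat_diff_reindex [symmetric]], intro sum.cong refl)
         (auto simp: mult.commute Suc_diff_Suc)
    then show ?thesis using rec [of a] by (simp add: algebra_simps)
  qed
  moreover have "horner_tail N b = X b"
    by (simp add: horner_tail_def)
  ultimately have "(\<Sum>s<Suc N. X (Suc a + s) * horner_tail s b)
      = (\<Sum>s<N. X (a + Suc s) * horner_tail (Suc s) (Suc b)) + X a * (p N * X b)"
    by (simp add: algebra_simps)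
  also have "\<dots> = (\<Sum>s<Suc N. X (a + s) * horner_tail s (Suc b))"
    by (subst sum.lessThan_Suc_shift) (simp add: horner_tail_0_Suc algebra_simps)
  finally show ?thesis .
qed

lemma hankel_expansion: "X (a + b) = (\<Sum>s<Suc N. X (a + s) * horner_tail s b)"
proof (induction a arbitrary: b)
  case 0
  \<comment> \<open>The initial values leave only s = N, where the tail reduces to X b.\<close>
  then show ?case by (simp add: init_0 init_1 horner_tail_def)
next
  case (Suc a)
  show ?case using Suc.IH [of "Suc b"] hankel_shift [of a b] by simp
qed

text \<open>Exchanging the sums over the triangle s + j < N brings each p j outside, so that the
  inner sums are convolutions.\<close>

lemma hankel_expansion_triangular:
  "X (a + b) = (\<Sum>s<Suc N. X (a + s) * X (b + (N - s)))
    - (\<Sum>j<N. p j * (\<Sum>s<N - j. X (a + s) * X (b + (N - 1 - s - j))))"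
proof -
  \<comment> \<open>It suffices to take s < N, since the coefficient sum of the tail at s = N is
    empty.\<close>
  have "(\<Sum>s<N. \<Sum>j<N - s. X (a + s) * (p j * X (b + (N - 1 - s - j))))
      = (\<Sum>s<N. \<Sum>j | j \<in> {..<N} \<and> s + j < N. X (a + s) * (p j * X (b + (N - 1 - s - j))))"
    by (intro sum.cong refl) auto
  also have "\<dots> = (\<Sum>j<N. \<Sum>s | s \<in> {..<N} \<and> s + j < N. X (a + s) * (p j * X (b + (N - 1 - s - j))))"
    by (rule sum.swap_restrict) auto
  also have "\<dots> = (\<Sum>j<N. p j * (\<Sum>s<N - j. X (a + s) * X (b + (N - 1 - s - j))))"
    unfolding sum_distrib_left
    by (intro sum.cong refl) (auto simp: algebra_simps)
  finally show ?thesis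
    by (subst hankel_expansion)
       (simp add: horner_tail_def right_diff_distrib sum_subtractf sum_distrib_left)
qed

text \<open>The sum may include j = N because the convolution there has length zero; this is the
  shape that \<open>pconv_fold\<close> treats, with length N + 1.\<close>

lemma double_index:
  "X (2 * k) = pconv X k (Suc N) - (\<Sum>j<Suc N. p j * pconv X k (N - j))"
proof -
  have "(\<Sum>s<N - j. X (k + s) * X (k + (N - 1 - s - j))) = pconv X k (N - j)" for j
    unfolding pconv_def by (intro sum.cong refl) (auto simp: add.commute)
  then show ?thesis
    using hankel_expansion_triangular [of k k] by (simp add: pconv_def mult_2)
qed

text \<open>At (a,b) = (k+1,k) each inner sum is a palindromic convolution plus one surplus product
  with factor X k. The recurrence collapses the surplus products to
  \<open>p N * X k ^ 2\<close>.\<close>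

lemma double_index_Suc:
  "X (2 * k + 1) = p N * X k ^ 2 + (pconv X (Suc k) N - (\<Sum>j<N. p j * pconv X (Suc k) (N - 1 - j)))"
proof -
  have conv: "(\<Sum>s<Suc r. X (Suc k + s) * X (k + (r - s))) = pconv X (Suc k) r + X (k + Suc r) * X k" for r
    unfolding pconv_Suc_base by simp
  have inner: "p j * (\<Sum>s<N - j. X (Suc k + s) * X (k + (N - 1 - s - j)))
      = p j * pconv X (Suc k) (N - 1 - j) + p j * X (k + N - j) * X k" if j: "j \<in> {..<N}" for j
  proof -
    obtain r where r: "N = Suc (j + r)"
      using j less_imp_Suc_add by blast
    have "(\<Sum>s<N - j. X (Suc k + s) * X (k + (N - 1 - s - j))) = (\<Sum>s<Suc r. X (Suc k + s) * X (k + (r - s)))"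
      by (intro sum.cong) (auto simp: r)
    moreover have "N - 1 - j = r" "k + N - j = k + Suc r"
      by (auto simp: r)
    ultimately show ?thesis
      by (simp only: conv distrib_left mult.assoc)
  qed
  have "X (2 * k + 1) = X (Suc k + k)"
    by (simp add: mult_2)
  also have "\<dots> = pconv X (Suc k) N + (\<Sum>i<Suc N. p i * X (k + N - i)) * X k
      - (\<Sum>j<N. p j * pconv X (Suc k) (N - 1 - j) + p j * X (k + N - j) * X k)"
    unfolding hankel_expansion_triangular [of "Suc k" k] conv rec [of k]
    by (intro arg_cong2 [of _ _ _ _ minus] sum.cong refl inner)
  finally show ?thesis
    by (simp add: sum.distrib algebra_simps power2_eq_square flip: sum_distrib_left)
qed

end

section \<open>Passage to integer bounds, floor and ceiling\<close>

lemma sum_int_eq_sum_nat: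
  fixes f :: "int \<Rightarrow> 'a :: comm_monoid_add"
  assumes "u = int m - 1"
  shows "sum f {0..u} = (\<Sum>i<m. f (int i))"
  \<comment> \<open>For m = 0 the bound u = -1 gives an empty interval, in accordance with the
    convention on empty sums.\<close>
  by (rule sum.reindex_bij_witness [where i = int and j = nat]) (use assms in auto)

theorem mainTheorem3:
  fixes n :: nat
    and p X :: "nat \<Rightarrow> 'a :: {comm_ring, semiring_numeral}"
    and e :: int
    and v :: real
  assumes "n \<ge> 1"
    and "\<And>j. j < n - 1 \<Longrightarrow> X j = 0"
    and "X (n - 1) = 1"
    and "\<And>k. X (k + n) = (\<Sum>i = 0..n - 1. p i * X (k + n - 1 - i))"
    and "e = int (n mod 2)"
    and "v = real n / 2 - 1"
  shows "\<forall>k :: nat.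
     X (2 * k) =
       (if odd n then X (k + (n - 1) div 2) ^ 2 else 0)
       + (\<Sum>i = 0..\<lfloor>v\<rfloor>. X (nat (int k + \<lfloor>v\<rfloor> - i)) *
           (2 * X (nat (int k + \<lceil>v\<rceil> + 1 + i))
            - p (nat (2 * i + e)) * X (nat (int k + \<lfloor>v\<rfloor> - i))
            - 2 * (\<Sum>j = 0..2 * i - 1 + e. p (nat j) * X (nat (int k + \<lceil>v\<rceil> + i - j)))))
   \<and> X (2 * k + 1) =
       p (n - 1) * X k ^ 2
       + (if even n then X (k + n div 2) ^ 2 else 0)
       + (\<Sum>i = 0..\<lceil>v\<rceil> - 1. X (nat (int k + \<lceil>v\<rceil> - i)) *
           (2 * X (nat (int k + \<lfloor>v\<rfloor> + 2 + i))
            - p (nat (2 * i + 1 - e)) * X (nat (int k + \<lceil>v\<rceil> - i))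
            - 2 * (\<Sum>j = 0..2 * i - e. p (nat j) * X (nat (int k + \<lfloor>v\<rfloor> + 1 + i - j)))))"
proof (rule allI, goal_cases)
  case (1 k)
  obtain N where N: "n = Suc N"
    using assms(1) by (cases n) auto
  have dbl: "X (2 * k) = pconv X k n - (\<Sum>j<n. p j * pconv X k (n - 1 - j))"
    and dbl_Suc: "X (2 * k + 1) = p (n - 1) * X k ^ 2
      + (pconv X (Suc k) (n - 1) - (\<Sum>j<n - 1. p j * pconv X (Suc k) (n - 1 - 1 - j)))"
  proof -
    have rec: "X (k + Suc N) = (\<Sum>i<Suc N. p i * X (k + N - i))" for k
      using assms(4) [of k] by (simp add: N atLeast0AtMost lessThan_Suc_atMost)
    show "X (2 * k) = pconv X k n - (\<Sum>j<n. p j * pconv X k (n - 1 - j))"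
      using double_index [of N X p k] assms(2,3) rec by (simp add: N)
    show "X (2 * k + 1) = p (n - 1) * X k ^ 2
      + (pconv X (Suc k) (n - 1) - (\<Sum>j<n - 1. p j * pconv X (Suc k) (n - 1 - 1 - j)))"
      using double_index_Suc [of N X p k] assms(2,3) rec by (simp add: N)
  qed
  \<comment> \<open>The convolutions for the even and the odd index have lengths n and n - 1; each
    length is split into a number of folded pairs and a parity.\<close>
  define h d where "h = n div 2" and "d = n mod 2"
  define h' d' where "h' = (n - 1) div 2" and "d' = (n - 1) mod 2"
  have parity: "d < 2" "d' < 2" "n = 2 * h + d" "n - 1 = 2 * h' + d'"
    by (simp_all add: h_def d_def h'_def d'_def)
  have "d + d' = 1"
    unfolding d_def d'_def N by (simp add: mod_Suc)
  \<comment> \<open>Since n and n - 1 have opposite parities, these relations translate between the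
    two splittings.\<close>
  then have "h = h' + d'" "h' + 1 = h + d"
    using parity assms(1) by linarith+
  note d = parity this \<open>d + d' = 1\<close>
  have e: "e = int d" "e = 1 - int d'"
    using \<open>d + d' = 1\<close> unfolding assms(5) d_def by linarith+
  have fl: "\<lfloor>v\<rfloor> = int h - 1" and ce: "\<lceil>v\<rceil> = int h'"
  proof -
    \<comment> \<open>Here v = h - 1 + d/2 = h' - d/2 with 0 \<le> d/2 < 1, which determines floor
      and ceiling.\<close>
    have "real n = 2 * real h + real d" "real h' + 1 = real h + real d" "0 \<le> real d" "real d < 2"
      using d(1,3,6) by linarith+
    then have "real_of_int (int h - 1) \<le> v" "v < real_of_int (int h - 1) + 1"
        "real_of_int (int h') - 1 < v" "v \<le> real_of_int (int h')"
      unfolding assms(6) of_int_diff of_int_of_nat_eq of_int_1 by linarith+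
    then show "\<lfloor>v\<rfloor> = int h - 1" "\<lceil>v\<rceil> = int h'"
      by (simp_all only: floor_unique ceiling_unique)
  qed
  have even: "X (2 * k) = (if odd n then X (k + (n - 1) div 2) ^ 2 else 0)
       + (\<Sum>i = 0..\<lfloor>v\<rfloor>. X (nat (int k + \<lfloor>v\<rfloor> - i)) *
           (2 * X (nat (int k + \<lceil>v\<rceil> + 1 + i))
            - p (nat (2 * i + e)) * X (nat (int k + \<lfloor>v\<rfloor> - i))
            - 2 * (\<Sum>j = 0..2 * i - 1 + e. p (nat j) * X (nat (int k + \<lceil>v\<rceil> + i - j)))))"
  proof -
    have "(\<Sum>i = 0..\<lfloor>v\<rfloor>. X (nat (int k + \<lfloor>v\<rfloor> - i)) *
           (2 * X (nat (int k + \<lceil>v\<rceil> + 1 + i))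
            - p (nat (2 * i + e)) * X (nat (int k + \<lfloor>v\<rfloor> - i))
            - 2 * (\<Sum>j = 0..2 * i - 1 + e. p (nat j) * X (nat (int k + \<lceil>v\<rceil> + i - j)))))
      = (\<Sum>i<h. X (k + (h - 1 - i)) *
          (2 * X (k + h + d + i) - p (2 * i + d) * X (k + (h - 1 - i))
            - 2 * (\<Sum>j<2 * i + d. p j * X (k + h + d + i - 1 - j))))"
      unfolding sum_int_eq_sum_nat [OF fl]
    proof (intro sum.cong refl)
      fix i assume "i \<in> {..<h}"
      then have le: "i < h" by simp
      then have i: "nat (int k + \<lfloor>v\<rfloor> - int i) = k + (h - 1 - i)"
          "nat (int k + \<lceil>v\<rceil> + 1 + int i) = k + h + d + i" "nat (2 * int i + e) = 2 * i + d"
        using d unfolding fl ce e(1) by linarith+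
      \<comment> \<open>The upper limit is (2i + d) - 1; at i = d = 0 it is -1 and the sum is
        empty.\<close>
      have "(\<Sum>j = 0..2 * int i - 1 + e. p (nat j) * X (nat (int k + \<lceil>v\<rceil> + int i - j)))
          = (\<Sum>j<2 * i + d. p (nat (int j)) * X (nat (int k + \<lceil>v\<rceil> + int i - int j)))"
        by (rule sum_int_eq_sum_nat) (simp add: e(1))
      also have "\<dots> = (\<Sum>j<2 * i + d. p j * X (k + h + d + i - 1 - j))"
      proof (intro sum.cong refl)
        fix j assume "j \<in> {..<2 * i + d}"
        then have "j < 2 * i + d" by simp
        \<comment> \<open>Because i < h and j < 2i + d, the index is at least k + h - i > 0, so no
          truncation occurs.\<close>
        then have "nat (int k + \<lceil>v\<rceil> + int i - int j) = k + h + d + i - 1 - j"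
          using le d unfolding ce by linarith
        then show "p (nat (int j)) * X (nat (int k + \<lceil>v\<rceil> + int i - int j)) = p j * X (k + h + d + i - 1 - j)"
          by (simp only: nat_int)
      qed
      finally show "X (nat (int k + \<lfloor>v\<rfloor> - int i)) *
           (2 * X (nat (int k + \<lceil>v\<rceil> + 1 + int i))
            - p (nat (2 * int i + e)) * X (nat (int k + \<lfloor>v\<rfloor> - int i))
            - 2 * (\<Sum>j = 0..2 * int i - 1 + e. p (nat j) * X (nat (int k + \<lceil>v\<rceil> + int i - j))))
        = X (k + (h - 1 - i)) *
          (2 * X (k + h + d + i) - p (2 * i + d) * X (k + (h - 1 - i))
            - 2 * (\<Sum>j<2 * i + d. p j * X (k + h + d + i - 1 - j)))"
        by (simp only: i)
    qed
    \<comment> \<open>For odd n, d' = 0 and thus h = h': the unpaired middle factor is the square in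
      the statement.\<close>
    moreover have "(if d = 1 then X (k + h) ^ 2 else 0) = (if odd n then X (k + (n - 1) div 2) ^ 2 else 0)"
    proof -
      have "d = 1 \<longleftrightarrow> odd n"
        unfolding d_def odd_iff_mod_2_eq_one ..
      moreover have "k + h = k + h'" if "d = 1"
        using that d by linarith
      ultimately show ?thesis by (simp add: h'_def)
    qed
    ultimately show ?thesis
      using dbl pconv_fold [OF d(1), of X k h p] by (simp only: d(3) [symmetric])
  qed
  have odd: "X (2 * k + 1) = p (n - 1) * X k ^ 2
       + (if even n then X (k + n div 2) ^ 2 else 0)
       + (\<Sum>i = 0..\<lceil>v\<rceil> - 1. X (nat (int k + \<lceil>v\<rceil> - i)) *
           (2 * X (nat (int k + \<lfloor>v\<rfloor> + 2 + i))
            - p (nat (2 * i + 1 - e)) * X (nat (int k + \<lceil>v\<rceil> - i))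
            - 2 * (\<Sum>j = 0..2 * i - e. p (nat j) * X (nat (int k + \<lfloor>v\<rfloor> + 1 + i - j)))))"
  proof -
    have ce': "\<lceil>v\<rceil> - 1 = int h' - 1" by (simp add: ce)
    have "(\<Sum>i = 0..\<lceil>v\<rceil> - 1. X (nat (int k + \<lceil>v\<rceil> - i)) *
           (2 * X (nat (int k + \<lfloor>v\<rfloor> + 2 + i))
            - p (nat (2 * i + 1 - e)) * X (nat (int k + \<lceil>v\<rceil> - i))
            - 2 * (\<Sum>j = 0..2 * i - e. p (nat j) * X (nat (int k + \<lfloor>v\<rfloor> + 1 + i - j)))))
      = (\<Sum>i<h'. X (Suc k + (h' - 1 - i)) *
          (2 * X (Suc k + h' + d' + i) - p (2 * i + d') * X (Suc k + (h' - 1 - i))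
            - 2 * (\<Sum>j<2 * i + d'. p j * X (Suc k + h' + d' + i - 1 - j))))"
      unfolding sum_int_eq_sum_nat [OF ce']
    proof (intro sum.cong refl)
      fix i assume "i \<in> {..<h'}"
      then have le: "i < h'" by simp
      \<comment> \<open>The base \<open>Suc k\<close> contributes the extra unit: k + h' - i = (k +
        1) + (h' - 1 - i), and k + h + 1 + i = (k + 1) + h' + d' + i.\<close>
      then have i: "nat (int k + \<lceil>v\<rceil> - int i) = Suc k + (h' - 1 - i)"
          "nat (int k + \<lfloor>v\<rfloor> + 2 + int i) = Suc k + h' + d' + i" "nat (2 * int i + 1 - e) = 2 * i + d'"
        using d unfolding fl ce e(2) by linarith+
      have "(\<Sum>j = 0..2 * int i - e. p (nat j) * X (nat (int k + \<lfloor>v\<rfloor> + 1 + int i - j)))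
          = (\<Sum>j<2 * i + d'. p (nat (int j)) * X (nat (int k + \<lfloor>v\<rfloor> + 1 + int i - int j)))"
        by (rule sum_int_eq_sum_nat) (simp add: e(2))
      also have "\<dots> = (\<Sum>j<2 * i + d'. p j * X (Suc k + h' + d' + i - 1 - j))"
      proof (intro sum.cong refl)
        fix j assume "j \<in> {..<2 * i + d'}"
        then have "j < 2 * i + d'" by simp
        then have "nat (int k + \<lfloor>v\<rfloor> + 1 + int i - int j) = Suc k + h' + d' + i - 1 - j"
          using le d unfolding fl by linarith
        then show "p (nat (int j)) * X (nat (int k + \<lfloor>v\<rfloor> + 1 + int i - int j)) = p j * X (Suc k + h' + d' + i - 1 - j)"
          by (simp only: nat_int)
      qed
      finally show "X (nat (int k + \<lceil>v\<rceil> - int i)) *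
           (2 * X (nat (int k + \<lfloor>v\<rfloor> + 2 + int i))
            - p (nat (2 * int i + 1 - e)) * X (nat (int k + \<lceil>v\<rceil> - int i))
            - 2 * (\<Sum>j = 0..2 * int i - e. p (nat j) * X (nat (int k + \<lfloor>v\<rfloor> + 1 + int i - j))))
        = X (Suc k + (h' - 1 - i)) *
          (2 * X (Suc k + h' + d' + i) - p (2 * i + d') * X (Suc k + (h' - 1 - i))
            - 2 * (\<Sum>j<2 * i + d'. p j * X (Suc k + h' + d' + i - 1 - j)))"
        by (simp only: i)
    qed
    \<comment> \<open>For even n, d' = 1 and h = h' + 1, so the middle index k + 1 + h' is k +
      n/2.\<close>
    moreover have "(if d' = 1 then X (Suc k + h') ^ 2 else 0) = (if even n then X (k + n div 2) ^ 2 else 0)"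
    proof -
      have "d' = 1 \<longleftrightarrow> even n"
        using \<open>d + d' = 1\<close> unfolding d_def even_iff_mod_2_eq_zero by linarith
      moreover have "X (Suc k + h') = X (k + h)" if "d' = 1"
        by (rule arg_cong) (use that d in linarith)
      ultimately show ?thesis unfolding h_def by presburger
    qed
    ultimately show ?thesis
      using dbl_Suc pconv_fold [OF d(2), of X "Suc k" h' p] by (simp only: d(4) [symmetric] add.assoc)
  qed
  show ?case
    using even odd by (rule conjI)
qed

end
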